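(* If $\{\langle X_i,\tau_i\rangle\}_{i\in I}$ is a family of compact MV-topological spaces, then their product space $\langle X,\tau_X\rangle$, where $X=\prod_{i\in I}X_i$ and $\tau_X$ is the product MV-topology, is compact.
   Context: On $[0,1]$ put $x\oplus y=\min(x+y,1)$, $x\odot y=\max(x+y-1,0)$, $x^*=1-x$, $x\wedge y=\min(x,y)$; these operations and arbitrary joins $\bigvee$ are extended pointwise to $[0,1]^X$. $\mathbf 0,\mathbf 1$ denote the constant functions $0,1$. An MV-topological space is a pair $\langle X,\tau\rangle$ with $X$ a set and $\tau\subseteq[0,1]^X$ such that $\mathbf 0,\mathbf 1\in\tau$, $\tau$ is closed under arbitrary joins, and $o_1\odot o_2,\ o_1\oplus o_2,\ o_1\wedge o_2\in\tau$ for all $o_1,o_2\in\tau$. Elements of $\tau$ are called open. A covering of $X$ is a subset $\Gamma\subseteq[0,1]^X$ with $\bigvee\Gamma=\mathbf 1$; it is open if $\Gamma\subseteq\tau$. An additive covering is a finite family $(\alpha_k)_{k=1}^n$ (repetitions allowed) of elements of $[0,1]^X$ with $\alpha_1\oplus\cdots\oplus\alpha_n=\mathbf 1$. The space $\langle X,\tau\rangle$ is compact if for every open covering $\Gamma$ there is an additive covering whose members all belong to $\Gamma$ (repetitions allowed). Product MV-topology: on $X=\prod_{i\in I}X_i$ with canonical projections $\pi_i$, $\tau_X$ is the MV-topology with subbase $S=\{\alpha\circ\pi_i\mid i\in I,\ \alpha\in\tau_i\}$, i.e. the smallest MV-topology on $X$ containing $S$ (for $I\neq\varnothing$ its elements are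 exactly the joins of finite combinations of elements of $S$ by $\oplus,\odot,\wedge$). *)

theory Defs
  imports Complex_Main "HOL-Library.FuncSet"
begin

text \<open>
  A fuzzy subset of a carrier \<open>X\<close>, i.e. an element of \<open>[0,1]\<^sup>X\<close>, is an extensional function in
  \<open>X \<rightarrow>\<^sub>E {0..1}\<close>, so that equality of HOL functions is equality on \<open>X\<close>.
\<close>

definition fuzzy_sets :: "'a set \<Rightarrow> ('a \<Rightarrow> real) set" where
  "fuzzy_sets X = X \<rightarrow>\<^sub>E {0..1}"

definition fuzzy_zero :: "'a set \<Rightarrow> 'a \<Rightarrow> real" where
  "fuzzy_zero X = (\<lambda>x\<in>X. 0)"

definition fuzzy_one :: "'a set \<Rightarrow> 'a \<Rightarrow> real" where
  "fuzzy_one X = (\<lambda>x\<in>X. 1)"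

definition fuzzy_oplus :: "'a set \<Rightarrow> ('a \<Rightarrow> real) \<Rightarrow> ('a \<Rightarrow> real) \<Rightarrow> 'a \<Rightarrow> real" where
  "fuzzy_oplus X f g = (\<lambda>x\<in>X. min (f x + g x) 1)"

definition fuzzy_odot :: "'a set \<Rightarrow> ('a \<Rightarrow> real) \<Rightarrow> ('a \<Rightarrow> real) \<Rightarrow> 'a \<Rightarrow> real" where
  "fuzzy_odot X f g = (\<lambda>x\<in>X. max (f x + g x - 1) 0)"

definition fuzzy_meet :: "'a set \<Rightarrow> ('a \<Rightarrow> real) \<Rightarrow> ('a \<Rightarrow> real) \<Rightarrow> 'a \<Rightarrow> real" where
  "fuzzy_meet X f g = (\<lambda>x\<in>X. min (f x) (g x))"

text \<open>
  The supremum is taken in \<open>[0,1]\<close>. Inserting its least element \<open>0\<close> changes nothing for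
  nonempty \<open>\<Gamma>\<close> and makes the join of the empty family \<open>0\<close>, whereas \<open>Sup {}\<close> is unspecified
  on the reals.
\<close>

definition fuzzy_Join :: "'a set \<Rightarrow> ('a \<Rightarrow> real) set \<Rightarrow> 'a \<Rightarrow> real" where
  "fuzzy_Join X \<Gamma> = (\<lambda>x\<in>X. Sup (insert 0 ((\<lambda>f. f x) ` \<Gamma>)))"

definition mv_topology :: "'a set \<Rightarrow> ('a \<Rightarrow> real) set \<Rightarrow> bool" where
  "mv_topology X \<tau> \<longleftrightarrow>
     \<tau> \<subseteq> fuzzy_sets X \<and>
     fuzzy_zero X \<in> \<tau> \<and> fuzzy_one X \<in> \<tau> \<and>
     (\<forall>\<Gamma>. \<Gamma> \<subseteq> \<tau> \<longrightarrow> fuzzy_Join X \<Gamma> \<in> \<tau>) \<and>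
     (\<forall>f\<in>\<tau>. \<forall>g\<in>\<tau>. fuzzy_odot X f g \<in> \<tau> \<and> fuzzy_oplus X f g \<in> \<tau> \<and> fuzzy_meet X f g \<in> \<tau>)"

definition fuzzy_covering :: "'a set \<Rightarrow> ('a \<Rightarrow> real) set \<Rightarrow> bool" where
  "fuzzy_covering X \<Gamma> \<longleftrightarrow> \<Gamma> \<subseteq> fuzzy_sets X \<and> fuzzy_Join X \<Gamma> = fuzzy_one X"

text \<open>
  Finite families with repetitions are lists. The sum of the empty list is \<open>0\<close>, so the empty
  list is an additive covering only of the empty carrier.
\<close>

definition additive_covering :: "'a set \<Rightarrow> ('a \<Rightarrow> real) list \<Rightarrow> bool" where
  "additive_covering X \<alpha>s \<longleftrightarrow>
     set \<alpha>s \<subseteq> fuzzy_sets X \<and> foldr (fuzzy_oplus X) \<alpha>s (fuzzy_zero X) = fuzzy_one X"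

definition mv_compact :: "'a set \<Rightarrow> ('a \<Rightarrow> real) set \<Rightarrow> bool" where
  "mv_compact X \<tau> \<longleftrightarrow>
     (\<forall>\<Gamma>. \<Gamma> \<subseteq> \<tau> \<and> fuzzy_covering X \<Gamma> \<longrightarrow> (\<exists>\<alpha>s. set \<alpha>s \<subseteq> \<Gamma> \<and> additive_covering X \<alpha>s))"

definition mv_topology_generated_by :: "'a set \<Rightarrow> ('a \<Rightarrow> real) set \<Rightarrow> ('a \<Rightarrow> real) set" where
  "mv_topology_generated_by X S = \<Inter> {\<tau>. mv_topology X \<tau> \<and> S \<subseteq> \<tau>}"

definition mv_product_subbase ::
    "'i set \<Rightarrow> ('i \<Rightarrow> 'a set) \<Rightarrow> ('i \<Rightarrow> ('a \<Rightarrow> real) set) \<Rightarrow> (('i \<Rightarrow> 'a) \<Rightarrow> real) set" where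
  "mv_product_subbase I X \<tau> = {compose (Pi\<^sub>E I X) \<alpha> (\<lambda>x. x i) | i \<alpha>. i \<in> I \<and> \<alpha> \<in> \<tau> i}"

definition mv_product_topology ::
    "'i set \<Rightarrow> ('i \<Rightarrow> 'a set) \<Rightarrow> ('i \<Rightarrow> ('a \<Rightarrow> real) set) \<Rightarrow> (('i \<Rightarrow> 'a) \<Rightarrow> real) set" where
  "mv_product_topology I X \<tau> = mv_topology_generated_by (Pi\<^sub>E I X) (mv_product_subbase I X \<tau>)"

text \<open>The product topology is indeed the smallest MV-topology containing the subbase.\<close>

lemma fuzzy_Join_in_fuzzy_sets:
  assumes "\<Gamma> \<subseteq> fuzzy_sets X"
  shows "fuzzy_Join X \<Gamma> \<in> fuzzy_sets X"
proof -
  have "0 \<le> Sup (insert 0 ((\<lambda>f. f x) ` \<Gamma>)) \<and> Sup (insert 0 ((\<lambda>f. f x) ` \<Gamma>)) \<le> 1" if "x \<in> X" for x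
  proof -
    have le1: "y \<le> 1" if "y \<in> insert 0 ((\<lambda>f. f x) ` \<Gamma>)" for y
      using that assms \<open>x \<in> X\<close> by (fastforce simp: fuzzy_sets_def PiE_iff)
    then have "bdd_above (insert 0 ((\<lambda>f. f x) ` \<Gamma>))"
      by (meson bdd_above.I)
    then have "0 \<le> Sup (insert 0 ((\<lambda>f. f x) ` \<Gamma>))"
      by (intro cSup_upper) auto
    moreover have "Sup (insert 0 ((\<lambda>f. f x) ` \<Gamma>)) \<le> 1"
      by (intro cSup_least) (use le1 in auto)
    ultimately show ?thesis by blast
  qed
  then show ?thesis
    by (auto simp: fuzzy_sets_def fuzzy_Join_def)
qed

lemma mv_topology_fuzzy_sets: "mv_topology X (fuzzy_sets X)"
proof -
  have "f x + g x \<le> 2" if "f \<in> fuzzy_sets X" "g \<in> fuzzy_sets X" "x \<in> X" for f g x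
    using that by (fastforce simp: fuzzy_sets_def PiE_iff)
  then show ?thesis
    unfolding mv_topology_def
    by (auto simp: fuzzy_Join_in_fuzzy_sets)
       (auto simp: fuzzy_sets_def fuzzy_zero_def fuzzy_one_def fuzzy_odot_def fuzzy_oplus_def
          fuzzy_meet_def PiE_iff min_def max_def intro: add_nonneg_nonneg)
qed

lemma mv_topology_generated_by:
  assumes "S \<subseteq> fuzzy_sets X"
  shows "mv_topology X (mv_topology_generated_by X S)"
proof -
  have sub: "mv_topology_generated_by X S \<subseteq> fuzzy_sets X"
    using assms mv_topology_fuzzy_sets unfolding mv_topology_generated_by_def by blast
  have join: "fuzzy_Join X \<Gamma> \<in> mv_topology_generated_by X S"
    if "\<Gamma> \<subseteq> mv_topology_generated_by X S" for \<Gamma>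
    unfolding mv_topology_generated_by_def
  proof (rule InterI, clarify)
    fix \<tau> assume \<tau>: "mv_topology X \<tau>" "S \<subseteq> \<tau>"
    then have "\<Gamma> \<subseteq> \<tau>"
      using that unfolding mv_topology_generated_by_def by blast
    then show "fuzzy_Join X \<Gamma> \<in> \<tau>"
      using \<tau>(1) unfolding mv_topology_def by blast
  qed
  show ?thesis
    unfolding mv_topology_def
    by (intro conjI sub ballI allI impI join)
       (auto simp: mv_topology_generated_by_def mv_topology_def)
qed

lemma mv_product_subbase_subset:
  assumes "\<And>i. i \<in> I \<Longrightarrow> mv_topology (X i) (\<tau> i)"
  shows "mv_product_subbase I X \<tau> \<subseteq> fuzzy_sets (Pi\<^sub>E I X)"
proof
  fix f assume "f \<in> mv_product_subbase I X \<tau>"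
  then obtain i \<alpha> where f: "f = compose (Pi\<^sub>E I X) \<alpha> (\<lambda>x. x i)" and i: "i \<in> I" and "\<alpha> \<in> \<tau> i"
    unfolding mv_product_subbase_def by blast
  then have "\<alpha> \<in> X i \<rightarrow>\<^sub>E {0..1}"
    using assms[OF i] unfolding mv_topology_def fuzzy_sets_def by blast
  then show "f \<in> fuzzy_sets (Pi\<^sub>E I X)"
    using i by (force simp: f fuzzy_sets_def compose_def PiE_iff)
qed

lemma mv_topology_product:
  assumes "\<And>i. i \<in> I \<Longrightarrow> mv_topology (X i) (\<tau> i)"
  shows "mv_topology (Pi\<^sub>E I X) (mv_product_topology I X \<tau>)"
  unfolding mv_product_topology_def
  by (intro mv_topology_generated_by mv_product_subbase_subset assms)

end

theory Submission
  imports Defs "HOL-Analysis.Function_Topology"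
begin

text \<open>
  The supports \<open>{\<alpha> > 0}\<close> of the open fuzzy sets of an MV-topology form an ordinary topology.
  Doubling \<open>\<alpha> \<oplus> \<alpha>\<close> and squaring \<open>\<alpha> \<odot> \<alpha>\<close> act on values like a binary shift, which makes every
  superlevel set \<open>{\<alpha> > t}\<close> open in it; and doubling turns a cover by supports into a fuzzy covering,
  so the support topology of a compact MV-space is compact. The lower semicontinuous functions on the
  product of the support topologies form an MV-topology containing the subbase. Hence for an open
  covering of the product MV-space the sets \<open>{\<gamma> > 1/2}\<close> are an ordinary open cover, Tychonoff's
  theorem yields finitely many of them, and each of the corresponding \<open>\<gamma>\<close> taken twice gives
  an additive covering.
\<close>

subsection \<open>The support topology\<close>

definition fuzzy_support :: "'a set \<Rightarrow> ('a \<Rightarrow> real) \<Rightarrow> 'a set" where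
  "fuzzy_support X \<alpha> = {x \<in> X. 0 < \<alpha> x}"

definition support_topology :: "'a set \<Rightarrow> ('a \<Rightarrow> real) set \<Rightarrow> 'a topology" where
  "support_topology X \<tau> = topology (\<lambda>U. U \<in> fuzzy_support X ` \<tau>)"

section \<open>Pointwise values of joins and finite sums\<close>

lemma fuzzy_sets_bounds:
  assumes "f \<in> fuzzy_sets X" "x \<in> X"
  shows "0 \<le> f x" "f x \<le> 1"
  using assms by (auto simp: fuzzy_sets_def PiE_iff)

text \<open>Strict inequalities avoid any attainment question for the supremum. The disjunct
  \<open>t < 0\<close> comes from the inserted \<open>0\<close> and adds something only when
  \<Gamma> is empty.\<close>

lemma less_fuzzy_Join_iff:
  assumes "\<Gamma> \<subseteq> fuzzy_sets X" "x \<in> X"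
  shows "t < fuzzy_Join X \<Gamma> x \<longleftrightarrow> t < 0 \<or> (\<exists>f\<in>\<Gamma>. t < f x)"
proof -
  have "bdd_above (insert 0 ((\<lambda>f. f x) ` \<Gamma>))"
    using fuzzy_sets_bounds(2)[OF subsetD[OF assms(1)] assms(2)]
    by (intro bdd_aboveI[of _ 1]) auto
  then show ?thesis
    using assms(2) by (simp add: fuzzy_Join_def less_cSup_iff)
qed

lemma fuzzy_coveringI:
  assumes "\<Gamma> \<subseteq> fuzzy_sets X" "\<And>x. x \<in> X \<Longrightarrow> \<exists>f\<in>\<Gamma>. f x = 1"
  shows "fuzzy_covering X \<Gamma>"
proof -
  have J: "fuzzy_Join X \<Gamma> \<in> fuzzy_sets X"
    using assms(1) by (rule fuzzy_Join_in_fuzzy_sets)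
  have "fuzzy_Join X \<Gamma> x = 1" if x: "x \<in> X" for x
  proof -
    have "\<not> fuzzy_Join X \<Gamma> x < 1"
      \<comment> \<open>With the join's own value as threshold, a member with value 1 would make the
        join exceed itself.\<close>
      using assms(2)[OF x] less_fuzzy_Join_iff[OF assms(1) x, of "fuzzy_Join X \<Gamma> x"] by force
    with fuzzy_sets_bounds(2)[OF J x] show ?thesis by simp
  qed
  moreover have "fuzzy_Join X \<Gamma> x = undefined" if "x \<notin> X" for x
    using that by (simp add: fuzzy_Join_def)
  ultimately have "fuzzy_Join X \<Gamma> = fuzzy_one X"
    by (auto simp: fuzzy_one_def)
  then show ?thesis
    using assms(1) by (simp add: fuzzy_covering_def)
qed

text \<open>Truncating at every step agrees with truncating once because the summands are
  nonnegative: a partial sum that has reached 1 stays there.\<close>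

lemma foldr_fuzzy_oplus_eq:
  assumes "set \<alpha>s \<subseteq> fuzzy_sets X" "x \<in> X"
  shows "foldr (fuzzy_oplus X) \<alpha>s (fuzzy_zero X) x = min 1 (\<Sum>\<alpha>\<leftarrow>\<alpha>s. \<alpha> x)"
  using assms
proof (induction \<alpha>s)
  case Nil
  then show ?case by (simp add: fuzzy_zero_def)
next
  case (Cons \<alpha> \<alpha>s)
  then have "0 \<le> \<alpha> x"
    by (auto intro: fuzzy_sets_bounds(1)[of \<alpha> X])
  with Cons show ?case
    by (auto simp: fuzzy_oplus_def min_def)
qed

lemma additive_covering_iff:
  "additive_covering X \<alpha>s \<longleftrightarrow> set \<alpha>s \<subseteq> fuzzy_sets X \<and> (\<forall>x\<in>X. 1 \<le> (\<Sum>\<alpha>\<leftarrow>\<alpha>s. \<alpha> x))"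
proof (cases "set \<alpha>s \<subseteq> fuzzy_sets X")
  case True
  have "foldr (fuzzy_oplus X) \<alpha>s (fuzzy_zero X) x = undefined" if "x \<notin> X" for x
    using that by (cases \<alpha>s) (simp_all add: fuzzy_oplus_def fuzzy_zero_def)
  then have "foldr (fuzzy_oplus X) \<alpha>s (fuzzy_zero X) = fuzzy_one X \<longleftrightarrow>
      (\<forall>x\<in>X. foldr (fuzzy_oplus X) \<alpha>s (fuzzy_zero X) x = 1)"
    by (auto simp: fuzzy_one_def fun_eq_iff restrict_def)
  also have "\<dots> \<longleftrightarrow> (\<forall>x\<in>X. 1 \<le> (\<Sum>\<alpha>\<leftarrow>\<alpha>s. \<alpha> x))"
    using True by (simp add: foldr_fuzzy_oplus_eq min_def)
  finally show ?thesis
    using True by (simp add: additive_covering_def)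
qed (simp add: additive_covering_def)

section \<open>Open supports and open superlevel sets\<close>

lemma fuzzy_support_Join:
  assumes "\<Gamma> \<subseteq> fuzzy_sets X"
  shows "fuzzy_support X (fuzzy_Join X \<Gamma>) = \<Union> (fuzzy_support X ` \<Gamma>)"
  using less_fuzzy_Join_iff[OF assms, of _ 0] by (auto simp: fuzzy_support_def)

text \<open>Intersections come from meets, as a minimum is positive iff both values are; unions come
  from joins.\<close>

lemma openin_support_topology:
  assumes "mv_topology X \<tau>"
  shows "openin (support_topology X \<tau>) U \<longleftrightarrow> U \<in> fuzzy_support X ` \<tau>"
proof -
  have "istopology (\<lambda>U. U \<in> fuzzy_support X ` \<tau>)"
    unfolding istopology_def
  proof (intro conjI allI impI)
    fix S T assume "S \<in> fuzzy_support X ` \<tau>" "T \<in> fuzzy_support X ` \<tau>"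
    then obtain f g where fg: "f \<in> \<tau>" "g \<in> \<tau>" "S = fuzzy_support X f" "T = fuzzy_support X g"
      by blast
    then have "S \<inter> T = fuzzy_support X (fuzzy_meet X f g)"
      by (auto simp: fuzzy_support_def fuzzy_meet_def)
    then show "S \<inter> T \<in> fuzzy_support X ` \<tau>"
      using assms fg unfolding mv_topology_def by blast
  next
    fix \<K> assume "\<forall>K\<in>\<K>. K \<in> fuzzy_support X ` \<tau>"
    then obtain \<Gamma> where \<Gamma>: "\<Gamma> \<subseteq> \<tau>" "\<K> = fuzzy_support X ` \<Gamma>"
      by (metis subset_imageE subsetI)
    then have "\<Union> \<K> = fuzzy_support X (fuzzy_Join X \<Gamma>)"
      using assms by (subst fuzzy_support_Join) (auto simp: mv_topology_def)
    then show "\<Union> \<K> \<in> fuzzy_support X ` \<tau>"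
      using assms \<Gamma>(1) unfolding mv_topology_def by blast
  qed
  then show ?thesis
    by (simp add: support_topology_def)
qed

lemma topspace_support_topology:
  assumes "mv_topology X \<tau>"
  shows "topspace (support_topology X \<tau>) = X"
proof -
  have "X = fuzzy_support X (fuzzy_one X)"
    by (auto simp: fuzzy_support_def fuzzy_one_def)
  then have "openin (support_topology X \<tau>) X"
    using assms by (auto simp: openin_support_topology mv_topology_def)
  moreover have "U \<subseteq> X" if "openin (support_topology X \<tau>) U" for U
    using that assms by (auto simp: openin_support_topology fuzzy_support_def)
  ultimately show ?thesis
    by (meson openin_subset openin_topspace subset_antisym)
qed

text \<open>
  Induction on the number of leading binary digits shared by \<open>t\<close> and \<open>\<alpha> x\<^sub>0\<close>:
  \<open>\<alpha> \<oplus> \<alpha>\<close> removes a leading \<open>0\<close>, \<open>\<alpha> \<odot> \<alpha>\<close> a leading \<open>1\<close>.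
\<close>

lemma superlevel_contains_support:
  assumes "mv_topology X \<tau>" "\<alpha> \<in> \<tau>" "x\<^sub>0 \<in> X" "0 \<le> t" "1 \<le> 2 ^ n * (\<alpha> x\<^sub>0 - t)"
  shows "\<exists>\<beta>\<in>\<tau>. 0 < \<beta> x\<^sub>0 \<and> (\<forall>x\<in>X. 0 < \<beta> x \<longrightarrow> t < \<alpha> x)"
  using assms(2,4,5)
proof (induction n arbitrary: \<alpha> t)
  case 0
  have "\<alpha> \<in> fuzzy_sets X"
    using assms(1) 0 by (auto simp: mv_topology_def)
  then have "\<alpha> x\<^sub>0 \<le> 1"
    using assms(3) by (rule fuzzy_sets_bounds(2))
  \<comment> \<open>A gap of at least 1 inside [0,1] leaves only \<open>t = 0\<close>, and \<alpha>
    is its own witness.\<close>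
  with 0 have "t = 0" "0 < \<alpha> x\<^sub>0" by auto
  with 0 show ?case by blast
next
  case (Suc n)
  have double: "fuzzy_oplus X \<alpha> \<alpha> \<in> \<tau>" and square: "fuzzy_odot X \<alpha> \<alpha> \<in> \<tau>"
    using assms(1) Suc.prems unfolding mv_topology_def by blast+
  have "0 < 2 ^ Suc n * (\<alpha> x\<^sub>0 - t)"
    using Suc.prems(3) by linarith
  then have lt: "t < \<alpha> x\<^sub>0"
    by (simp add: zero_less_mult_iff)
  have scaled: "1 \<le> 2 ^ n * (2 * \<alpha> x\<^sub>0 - 2 * t)"
    using Suc.prems(3) by (simp add: algebra_simps)
  \<comment> \<open>Both leading digits are 1, or the digits differ, or both are 0. In the outer
    cases no truncation occurs at \<open>x\<^sub>0\<close>, so the gap doubles and pays for lowering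
    \<open>n\<close>. In the middle case the square is the witness: it is positive only where
    \<alpha> exceeds 1/2.\<close>
  consider "1/2 \<le> t" | "t < 1/2" "1/2 < \<alpha> x\<^sub>0" | "\<alpha> x\<^sub>0 \<le> 1/2"
    by linarith
  then show ?case
  proof cases
    case 1
    then have "fuzzy_odot X \<alpha> \<alpha> x\<^sub>0 - (2 * t - 1) = 2 * \<alpha> x\<^sub>0 - 2 * t"
      using lt assms(3) by (simp add: fuzzy_odot_def)
    with Suc.IH[OF square, of "2 * t - 1"] 1 scaled obtain \<beta> where
      "\<beta> \<in> \<tau>" "0 < \<beta> x\<^sub>0" "\<forall>x\<in>X. 0 < \<beta> x \<longrightarrow> 2 * t - 1 < fuzzy_odot X \<alpha> \<alpha> x"
      by auto
    with 1 show ?thesis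
      by (intro bexI[of _ \<beta>]) (auto simp: fuzzy_odot_def max_def split: if_splits)
  next
    case 2
    then show ?thesis
      using assms(3) by (intro bexI[OF _ square]) (auto simp: fuzzy_odot_def)
  next
    case 3
    then have "fuzzy_oplus X \<alpha> \<alpha> x\<^sub>0 - 2 * t = 2 * \<alpha> x\<^sub>0 - 2 * t"
      using assms(3) by (simp add: fuzzy_oplus_def)
    with Suc.IH[OF double, of "2 * t"] Suc.prems(2) scaled obtain \<beta> where
      "\<beta> \<in> \<tau>" "0 < \<beta> x\<^sub>0" "\<forall>x\<in>X. 0 < \<beta> x \<longrightarrow> 2 * t < fuzzy_oplus X \<alpha> \<alpha> x"
      by auto
    then show ?thesis
      by (intro bexI[of _ \<beta>]) (auto simp: fuzzy_oplus_def)
  qed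
qed

lemma openin_support_topology_superlevel:
  assumes "mv_topology X \<tau>" "\<alpha> \<in> \<tau>"
  shows "openin (support_topology X \<tau>) {x \<in> X. t < \<alpha> x}"
proof (cases "0 \<le> t")
  case True
  show ?thesis
  proof (subst openin_subopen, intro ballI)
    fix x\<^sub>0 assume x0: "x\<^sub>0 \<in> {x \<in> X. t < \<alpha> x}"
    then obtain n where "1 / (\<alpha> x\<^sub>0 - t) < 2 ^ n"
      using real_arch_pow[of 2] by auto
    then have "1 \<le> 2 ^ n * (\<alpha> x\<^sub>0 - t)"
      using x0 by (simp add: field_simps)
    then obtain \<beta> where \<beta>: "\<beta> \<in> \<tau>" "0 < \<beta> x\<^sub>0" "\<forall>x\<in>X. 0 < \<beta> x \<longrightarrow> t < \<alpha> x"
      using superlevel_contains_support[OF assms, of x\<^sub>0 t n] True x0 by auto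
    then show "\<exists>T. openin (support_topology X \<tau>) T \<and> x\<^sub>0 \<in> T \<and> T \<subseteq> {x \<in> X. t < \<alpha> x}"
      using x0 assms(1)
      by (intro exI[of _ "fuzzy_support X \<beta>"])
        (auto simp: openin_support_topology fuzzy_support_def)
  qed
next
  case False
  have "\<alpha> \<in> fuzzy_sets X"
    using assms by (auto simp: mv_topology_def)
  with False have "{x \<in> X. t < \<alpha> x} = topspace (support_topology X \<tau>)"
    using fuzzy_sets_bounds(1)[of \<alpha> X] assms(1)
    by (force simp: topspace_support_topology)
  then show ?thesis by simp
qed

section \<open>Doubling and compactness of the support topology\<close>

lemma fuzzy_support_double:
  "fuzzy_support X (fuzzy_oplus X \<alpha> \<alpha>) = fuzzy_support X \<alpha>"
  by (auto simp: fuzzy_support_def fuzzy_oplus_def)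

lemma funpow_double:
  assumes "\<alpha> \<in> fuzzy_sets X" "x \<in> X"
  shows "((\<lambda>\<beta>. fuzzy_oplus X \<beta> \<beta>) ^^ n) \<alpha> x = min (2 ^ n * \<alpha> x) 1"
proof (induction n)
  case 0
  then show ?case
    using fuzzy_sets_bounds(2)[OF assms] by simp
next
  case (Suc n)
  then show ?case
    using assms(2) by (simp add: fuzzy_oplus_def min_def)
qed

lemma compact_space_support_topology:
  assumes "mv_topology X \<tau>" "mv_compact X \<tau>"
  shows "compact_space (support_topology X \<tau>)"
  unfolding compact_space_alt topspace_support_topology[OF assms(1)]
proof (intro allI impI, elim conjE)
  fix \<U> assume op: "\<forall>U\<in>\<U>. openin (support_topology X \<tau>) U" and cov: "X \<subseteq> \<Union> \<U>"
  \<comment> \<open>All open fuzzy sets with support in the cover are taken, not one per support, so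
    that \<Gamma> is closed under doubling.\<close>
  define \<Gamma> where "\<Gamma> = {\<alpha> \<in> \<tau>. fuzzy_support X \<alpha> \<in> \<U>}"
  have \<tau>: "\<tau> \<subseteq> fuzzy_sets X"
    using assms(1) by (simp add: mv_topology_def)
  have double: "((\<lambda>\<beta>. fuzzy_oplus X \<beta> \<beta>) ^^ n) \<alpha> \<in> \<Gamma>" if "\<alpha> \<in> \<Gamma>" for \<alpha> n
    using that assms(1)
    by (induction n) (auto simp: \<Gamma>_def mv_topology_def fuzzy_support_double)
  have "fuzzy_covering X \<Gamma>"
  proof (rule fuzzy_coveringI)
    show "\<Gamma> \<subseteq> fuzzy_sets X"
      using \<tau> by (auto simp: \<Gamma>_def)
    fix x assume x: "x \<in> X"
    then obtain U where U: "U \<in> \<U>" "x \<in> U"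
      using cov by blast
    then obtain \<alpha> where \<alpha>: "\<alpha> \<in> \<tau>" "U = fuzzy_support X \<alpha>"
      using op assms(1) by (auto simp: openin_support_topology)
    with U have "\<alpha> \<in> \<Gamma>" "0 < \<alpha> x"
      by (auto simp: \<Gamma>_def fuzzy_support_def)
    obtain n where "1 / \<alpha> x < 2 ^ n"
      using real_arch_pow[of 2] by auto
    then have "1 \<le> 2 ^ n * \<alpha> x"
      using \<open>0 < \<alpha> x\<close> by (simp add: field_simps)
    then have "((\<lambda>\<beta>. fuzzy_oplus X \<beta> \<beta>) ^^ n) \<alpha> x = 1"
      using \<alpha>(1) \<tau> x by (auto simp: funpow_double)
    with double[OF \<open>\<alpha> \<in> \<Gamma>\<close>] show "\<exists>f\<in>\<Gamma>. f x = 1"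
      by blast
  qed
  moreover have "\<Gamma> \<subseteq> \<tau>"
    by (auto simp: \<Gamma>_def)
  ultimately obtain \<alpha>s where \<alpha>s: "set \<alpha>s \<subseteq> \<Gamma>" "additive_covering X \<alpha>s"
    using assms(2) unfolding mv_compact_def by blast
  \<comment> \<open>A sum of at least 1 has a positive summand, so the supports of the finite family
    cover.\<close>
  have "x \<in> \<Union> (fuzzy_support X ` set \<alpha>s)" if x: "x \<in> X" for x
  proof (rule ccontr)
    assume "x \<notin> \<Union> (fuzzy_support X ` set \<alpha>s)"
    then have "\<alpha> x \<le> 0" if "\<alpha> \<in> set \<alpha>s" for \<alpha>
      using that x by (force simp: fuzzy_support_def)
    then have "(\<Sum>\<alpha>\<leftarrow>\<alpha>s. \<alpha> x) \<le> 0"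
      by (intro sum_list_nonpos) auto
    moreover have "1 \<le> (\<Sum>\<alpha>\<leftarrow>\<alpha>s. \<alpha> x)"
      using \<alpha>s(2) x by (simp add: additive_covering_iff)
    ultimately show False by simp
  qed
  then show "\<exists>\<F>. finite \<F> \<and> \<F> \<subseteq> \<U> \<and> X \<subseteq> \<Union> \<F>"
    using \<alpha>s(1) by (intro exI[of _ "fuzzy_support X ` set \<alpha>s"]) (auto simp: \<Gamma>_def)
qed

subsection \<open>Lower semicontinuous functions\<close>

definition lsc_fuzzy_sets :: "'a topology \<Rightarrow> ('a \<Rightarrow> real) set" where
  "lsc_fuzzy_sets T = {f \<in> fuzzy_sets (topspace T). \<forall>t. openin T {x \<in> topspace T. t < f x}}"

text \<open>A sum exceeds \<open>t\<close> iff some \<open>s\<close> splits the bound into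
  \<open>s < f x\<close> and \<open>t - s < g x\<close>; this gives a union of open
  intersections.\<close>

lemma openin_superlevel_add:
  fixes f g :: "'a \<Rightarrow> real"
  assumes "\<And>t. openin T {x \<in> topspace T. t < f x}" "\<And>t. openin T {x \<in> topspace T. t < g x}"
  shows "openin T {x \<in> topspace T. t < f x + g x}"
proof -
  have "\<exists>s. s < f x \<and> t - s < g x" if "t < f x + g x" for x
  proof -
    obtain s where "t - g x < s" "s < f x"
      using dense[of "t - g x" "f x"] \<open>t < f x + g x\<close> by (auto simp: algebra_simps)
    then show ?thesis
      by (intro exI[of _ s]) auto
  qed
  then have "{x \<in> topspace T. t < f x + g x} =
      (\<Union>s. {x \<in> topspace T. s < f x} \<inter> {x \<in> topspace T. t - s < g x})"
    by fastforce
  moreover have "openin T (\<Union>s. {x \<in> topspace T. s < f x} \<inter> {x \<in> topspace T. t - s < g x})"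
    using assms by (intro openin_Union) blast
  ultimately show ?thesis by simp
qed

lemma mv_topology_lsc_fuzzy_sets: "mv_topology (topspace T) (lsc_fuzzy_sets T)"
proof -
  let ?X = "topspace T"
  have fs: "mv_topology ?X (fuzzy_sets ?X)"
    by (rule mv_topology_fuzzy_sets)
  have const: "openin T {x \<in> ?X. t < (\<lambda>x\<in>?X. c) x}" for c t :: real
  proof -
    have "{x \<in> ?X. t < (\<lambda>x\<in>?X. c) x} = (if t < c then ?X else {})"
      by auto
    then show ?thesis by simp
  qed
  have join: "fuzzy_Join ?X \<Gamma> \<in> lsc_fuzzy_sets T" if "\<Gamma> \<subseteq> lsc_fuzzy_sets T" for \<Gamma>
  proof -
    have \<Gamma>: "\<Gamma> \<subseteq> fuzzy_sets ?X"
      using that by (auto simp: lsc_fuzzy_sets_def)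
    have "openin T {x \<in> ?X. t < fuzzy_Join ?X \<Gamma> x}" for t
    proof (cases "t < 0")
      case True
      then have "{x \<in> ?X. t < fuzzy_Join ?X \<Gamma> x} = ?X"
        using less_fuzzy_Join_iff[OF \<Gamma>] by auto
      then show ?thesis by simp
    next
      case False
      then have "{x \<in> ?X. t < fuzzy_Join ?X \<Gamma> x} = (\<Union>f\<in>\<Gamma>. {x \<in> ?X. t < f x})"
        using less_fuzzy_Join_iff[OF \<Gamma>] by auto
      moreover have "openin T (\<Union>f\<in>\<Gamma>. {x \<in> ?X. t < f x})"
        using that unfolding lsc_fuzzy_sets_def by (intro openin_Union) blast
      ultimately show ?thesis by simp
    qed
    then show ?thesis
      using \<Gamma> by (simp add: lsc_fuzzy_sets_def fuzzy_Join_in_fuzzy_sets)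
  qed
  have ops: "fuzzy_odot ?X f g \<in> lsc_fuzzy_sets T \<and> fuzzy_oplus ?X f g \<in> lsc_fuzzy_sets T \<and>
      fuzzy_meet ?X f g \<in> lsc_fuzzy_sets T"
    if "f \<in> lsc_fuzzy_sets T" "g \<in> lsc_fuzzy_sets T" for f g
  proof -
    have f: "f \<in> fuzzy_sets ?X" "\<And>t. openin T {x \<in> ?X. t < f x}"
      and g: "g \<in> fuzzy_sets ?X" "\<And>t. openin T {x \<in> ?X. t < g x}"
      using that unfolding lsc_fuzzy_sets_def by blast+
    note add = openin_superlevel_add[OF f(2) g(2)]
    \<comment> \<open>Truncation only affects thresholds outside the range: below 0 the set is
      everything, and for \<open>fuzzy_oplus\<close> from 1 upwards it is empty. Otherwise it is a
      superlevel set of the plain sum.\<close>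
    have "{x \<in> ?X. t < fuzzy_odot ?X f g x} =
        (if t < 0 then ?X else {x \<in> ?X. t + 1 < f x + g x})" for t
      by (auto simp: fuzzy_odot_def)
    then have "openin T {x \<in> ?X. t < fuzzy_odot ?X f g x}" for t
      using add by simp
    moreover have "{x \<in> ?X. t < fuzzy_oplus ?X f g x} =
        (if t < 1 then {x \<in> ?X. t < f x + g x} else {})" for t
      by (auto simp: fuzzy_oplus_def)
    then have "openin T {x \<in> ?X. t < fuzzy_oplus ?X f g x}" for t
      using add by simp
    moreover have "{x \<in> ?X. t < fuzzy_meet ?X f g x} =
        {x \<in> ?X. t < f x} \<inter> {x \<in> ?X. t < g x}" for t
      by (auto simp: fuzzy_meet_def)
    then have "openin T {x \<in> ?X. t < fuzzy_meet ?X f g x}" for t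
      using f(2) g(2) by (simp add: openin_Int)
    ultimately show ?thesis
      using f(1) g(1) fs by (simp add: lsc_fuzzy_sets_def mv_topology_def)
  qed
  show ?thesis
    using fs const join ops
    by (auto simp: mv_topology_def lsc_fuzzy_sets_def fuzzy_zero_def fuzzy_one_def)
qed

section \<open>The product MV-topology\<close>

lemma mv_product_topology_subset_lsc:
  assumes "\<And>i. i \<in> I \<Longrightarrow> mv_topology (X i) (\<tau> i)"
  shows "mv_product_topology I X \<tau> \<subseteq>
    lsc_fuzzy_sets (product_topology (\<lambda>i. support_topology (X i) (\<tau> i)) I)"
    (is "_ \<subseteq> lsc_fuzzy_sets ?T")
proof -
  have top: "topspace ?T = Pi\<^sub>E I X"
    using assms by (auto simp: topspace_support_topology intro!: PiE_cong)
  have "mv_product_subbase I X \<tau> \<subseteq> lsc_fuzzy_sets ?T"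
  proof
    fix f assume f: "f \<in> mv_product_subbase I X \<tau>"
    then obtain i \<alpha> where i: "i \<in> I" "\<alpha> \<in> \<tau> i" "f = compose (Pi\<^sub>E I X) \<alpha> (\<lambda>x. x i)"
      unfolding mv_product_subbase_def by blast
    have "openin ?T {x \<in> topspace ?T. t < f x}" for t
    proof -
      \<comment> \<open>A superlevel set of a subbasic function is the preimage of one of \<alpha>
        under a continuous projection.\<close>
      have "openin ?T {x \<in> topspace ?T. x i \<in> {y \<in> X i. t < \<alpha> y}}"
        using i assms
        by (intro openin_continuous_map_preimage[OF continuous_map_product_projection]
            openin_support_topology_superlevel)
      moreover have "{x \<in> topspace ?T. x i \<in> {y \<in> X i. t < \<alpha> y}} = {x \<in> topspace ?T. t < f x}"
        unfolding top using i by (auto simp: compose_def)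
      ultimately show ?thesis by simp
    qed
    moreover have "f \<in> fuzzy_sets (topspace ?T)"
      using mv_product_subbase_subset[of I X \<tau>] assms f top by auto
    ultimately show "f \<in> lsc_fuzzy_sets ?T"
      by (simp add: lsc_fuzzy_sets_def)
  qed
  moreover have "mv_topology (Pi\<^sub>E I X) (lsc_fuzzy_sets ?T)"
    using mv_topology_lsc_fuzzy_sets[of ?T] unfolding top .
  \<comment> \<open>The generated MV-topology is an intersection, hence contained in this particular
    MV-topology.\<close>
  ultimately show ?thesis
    unfolding mv_product_topology_def mv_topology_generated_by_def by blast
qed

section \<open>From ordinary compactness to additive coverings\<close>

lemma mv_compact_lsc_fuzzy_sets:
  assumes "compact_space T"
  shows "mv_compact (topspace T) (lsc_fuzzy_sets T)"
  unfolding mv_compact_def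
proof (intro allI impI, elim conjE)
  fix \<Gamma> assume lsc: "\<Gamma> \<subseteq> lsc_fuzzy_sets T" and cov: "fuzzy_covering (topspace T) \<Gamma>"
  \<comment> \<open>Any threshold strictly between 0 and 1 would serve, with enough repetitions; 1/2
    needs two copies.\<close>
  define U where "U \<gamma> = {x \<in> topspace T. 1/2 < \<gamma> x}" for \<gamma> :: "'a \<Rightarrow> real"
  have \<Gamma>: "\<Gamma> \<subseteq> fuzzy_sets (topspace T)"
    using cov by (simp add: fuzzy_covering_def)
  have "\<exists>\<gamma>\<in>\<Gamma>. 1/2 < \<gamma> x" if "x \<in> topspace T" for x
    using less_fuzzy_Join_iff[OF \<Gamma> that, of "1/2"] cov that
    by (simp add: fuzzy_covering_def fuzzy_one_def)
  then have "topspace T \<subseteq> \<Union> (U ` \<Gamma>)"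
    by (auto simp: U_def)
  moreover have "\<forall>V\<in>U ` \<Gamma>. openin T V"
    using lsc unfolding U_def lsc_fuzzy_sets_def by blast
  ultimately obtain \<F> where \<F>: "finite \<F>" "\<F> \<subseteq> U ` \<Gamma>" "topspace T \<subseteq> \<Union> \<F>"
    using assms unfolding compact_space_alt by meson
  then obtain \<Delta> where \<Delta>: "\<Delta> \<subseteq> \<Gamma>" "finite \<Delta>" "\<F> = U ` \<Delta>"
    by (meson finite_subset_image)
  then obtain \<alpha>s where \<alpha>s: "set \<alpha>s = \<Delta>"
    using finite_list by blast
  have "1 \<le> (\<Sum>\<alpha>\<leftarrow>\<alpha>s @ \<alpha>s. \<alpha> x)" if x: "x \<in> topspace T" for x
  proof -
    obtain \<gamma> where "\<gamma> \<in> set \<alpha>s" "1/2 < \<gamma> x"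
      using \<F>(3) x \<Delta>(3) \<alpha>s by (auto simp: U_def)
    moreover have "\<gamma> x \<le> (\<Sum>\<alpha>\<leftarrow>\<alpha>s. \<alpha> x)"
      using \<open>\<gamma> \<in> set \<alpha>s\<close> \<alpha>s \<Delta>(1) \<Gamma> x
      by (intro member_le_sum_list) (auto intro: fuzzy_sets_bounds(1)[of _ "topspace T"])
    ultimately show ?thesis by simp
  qed
  then have "additive_covering (topspace T) (\<alpha>s @ \<alpha>s)"
    using \<alpha>s \<Delta>(1) \<Gamma> by (auto simp: additive_covering_iff)
  then show "\<exists>\<alpha>s. set \<alpha>s \<subseteq> \<Gamma> \<and> additive_covering (topspace T) \<alpha>s"
    using \<alpha>s \<Delta>(1) by (intro exI[of _ "\<alpha>s @ \<alpha>s"]) simp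
qed

theorem theorem5p3:
  fixes I :: "'i set"
    and X :: "'i \<Rightarrow> 'a set"
    and \<tau> :: "'i \<Rightarrow> ('a \<Rightarrow> real) set"
  assumes "\<And>i. i \<in> I \<Longrightarrow> mv_topology (X i) (\<tau> i)"
    and "\<And>i. i \<in> I \<Longrightarrow> mv_compact (X i) (\<tau> i)"
  shows "mv_compact (Pi\<^sub>E I X) (mv_product_topology I X \<tau>)"
proof -
  let ?T = "product_topology (\<lambda>i. support_topology (X i) (\<tau> i)) I"
  have "topspace ?T = Pi\<^sub>E I X"
    using assms(1) by (auto simp: topspace_support_topology intro!: PiE_cong)
  \<comment> \<open>This is Tychonoff's theorem.\<close>
  moreover have "compact_space ?T"
    using assms by (simp add: compact_space_product_topology compact_space_support_topology)
  ultimately have "mv_compact (Pi\<^sub>E I X) (lsc_fuzzy_sets ?T)"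
    using mv_compact_lsc_fuzzy_sets[of ?T] by simp
  \<comment> \<open>Compactness passes to a smaller family of open sets, since the additive covering
    is drawn from \<Gamma> itself.\<close>
  then show ?thesis
    using mv_product_topology_subset_lsc[of I X \<tau>] assms(1) unfolding mv_compact_def by blast
qed

end
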